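(* Let $\alpha_i,\beta_i,\gamma_i$ ($i=1,2,3$) be real numbers such that $$\operatorname{Rank}\begin{pmatrix}\alpha_1&\beta_1&\gamma_1&0&0&0\\ \alpha_2&\beta_2&\gamma_2&0&0&0\\ 0&0&0&\alpha_3&\beta_3&\gamma_3\end{pmatrix}=3,$$ and let $B_1[u]=\alpha_1u(0)+\beta_1u'(0)+\gamma_1u''(0)$, $B_2[u]=\alpha_2u(0)+\beta_2u'(0)+\gamma_2u''(0)$, $B_3[u]=\alpha_3u(1)+\beta_3u'(1)+\gamma_3u''(1)$. Assume the problem $u'''=\varphi$ on $(0,1)$, $B_1[u]=B_2[u]=B_3[u]=0$ has a Green function $G(t,s)$, set $G_1=\partial G/\partial t$, $G_2=\partial^2G/\partial t^2$ and $$M_0=\max_{0\le t\le1}\int_0^1|G(t,s)|ds,\quad M_1=\max_{0\le t\le1}\int_0^1|G_1(t,s)|ds,\quad M_2=\max_{0\le t\le1}\int_0^1|G_2(t,s)|ds.$$ For $M>0$ let $\mathcal{D}_M=\{(t,x,y,z): 0\le t\le1,\ |x|\le M_0M,\ |y|\le M_1M,\ |z|\le M_2M\}$. Assume there exist numbers $M,L_0,L_1,L_2\ge0$ such that $f$ is continuous on $\mathcal{D}_M$, $|f(t,x,y,z)|\le M$ for all $(t,x,y,z)\in\mathcal{D}_M$, $$|f(t,x_2,y_2,z_2)-f(t,x_1,y_1,z_1)|\le L_0|x_2-x_1|+L_1|y_2-y_1|+L_2|z_2-z_1|$$ for all $(t,x_i,y_i,z_i)\in\mathcal{D}_M$ ($i=1,2$),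 and $q:=L_0M_0+L_1M_1+L_2M_2<1$. Then the problem $$u'''(t)=f(t,u(t),u'(t),u''(t)),\ 0<t<1,\qquad B_1[u]=B_2[u]=B_3[u]=0$$ has a unique solution $u$ such that $|u(t)|\le M_0M$, $|u'(t)|\le M_1M$, $|u''(t)|\le M_2M$ for all $0\le t\le1$.
   Context: The Green function $G(t,s)$ of the linear problem $u'''=\varphi$, $B_1[u]=B_2[u]=B_3[u]=0$ is the function on $[0,1]^2$ such that for every $\varphi\in C[0,1]$ the unique solution is $u(t)=\int_0^1G(t,s)\varphi(s)ds$. *)

theory Defs
  imports "HOL-Analysis.Analysis"
begin

definition bc_matrix :: "real \<Rightarrow> real \<Rightarrow> real \<Rightarrow> real \<Rightarrow> real \<Rightarrow> real \<Rightarrow> real \<Rightarrow> real \<Rightarrow> real \<Rightarrow> real^6^3" where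
  "bc_matrix a1 b1 c1 a2 b2 c2 a3 b3 c3 =
     vector [vector [a1, b1, c1, 0, 0, 0],
             vector [a2, b2, c2, 0, 0, 0],
             vector [0, 0, 0, a3, b3, c3]]"

definition deriv3_on01 :: "(real \<Rightarrow> real) \<Rightarrow> (real \<Rightarrow> real) \<Rightarrow> (real \<Rightarrow> real) \<Rightarrow> (real \<Rightarrow> real) \<Rightarrow> bool" where
  "deriv3_on01 u u1 u2 u3 \<longleftrightarrow>
     (\<forall>t\<in>{0..1}. (u has_real_derivative u1 t) (at t within {0..1}) \<and>
                 (u1 has_real_derivative u2 t) (at t within {0..1})) \<and>
     (\<forall>t\<in>{0<..<1}. (u2 has_real_derivative u3 t) (at t))"

definition bcs :: "real \<Rightarrow> real \<Rightarrow> real \<Rightarrow> real \<Rightarrow> real \<Rightarrow> real \<Rightarrow> real \<Rightarrow> real \<Rightarrow> real \<Rightarrow>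
    (real \<Rightarrow> real) \<Rightarrow> (real \<Rightarrow> real) \<Rightarrow> (real \<Rightarrow> real) \<Rightarrow> bool" where
  "bcs a1 b1 c1 a2 b2 c2 a3 b3 c3 u u1 u2 \<longleftrightarrow>
     a1 * u 0 + b1 * u1 0 + c1 * u2 0 = 0 \<and>
     a2 * u 0 + b2 * u1 0 + c2 * u2 0 = 0 \<and>
     a3 * u 1 + b3 * u1 1 + c3 * u2 1 = 0"

definition lin_sol :: "real \<Rightarrow> real \<Rightarrow> real \<Rightarrow> real \<Rightarrow> real \<Rightarrow> real \<Rightarrow> real \<Rightarrow> real \<Rightarrow> real \<Rightarrow>
    (real \<Rightarrow> real) \<Rightarrow> (real \<Rightarrow> real) \<Rightarrow> bool" where
  "lin_sol a1 b1 c1 a2 b2 c2 a3 b3 c3 phi u \<longleftrightarrow>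
     (\<exists>u1 u2. deriv3_on01 u u1 u2 phi \<and> bcs a1 b1 c1 a2 b2 c2 a3 b3 c3 u u1 u2)"

definition is_green_fun :: "real \<Rightarrow> real \<Rightarrow> real \<Rightarrow> real \<Rightarrow> real \<Rightarrow> real \<Rightarrow> real \<Rightarrow> real \<Rightarrow> real \<Rightarrow>
    (real \<Rightarrow> real \<Rightarrow> real) \<Rightarrow> bool" where
  "is_green_fun a1 b1 c1 a2 b2 c2 a3 b3 c3 G \<longleftrightarrow>
     (\<forall>phi. continuous_on {0..1} phi \<longrightarrow>
        (\<forall>t\<in>{0..1}. (\<lambda>s. G t s * phi s) integrable_on {0..1}) \<and>
        lin_sol a1 b1 c1 a2 b2 c2 a3 b3 c3 phi (\<lambda>t. integral {0..1} (\<lambda>s. G t s * phi s)) \<and>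
        (\<forall>u. lin_sol a1 b1 c1 a2 b2 c2 a3 b3 c3 phi u \<longrightarrow>
              (\<forall>t\<in>{0..1}. u t = integral {0..1} (\<lambda>s. G t s * phi s))))"

definition max_abs_int :: "(real \<Rightarrow> real \<Rightarrow> real) \<Rightarrow> real" where
  "max_abs_int K = (SUP t\<in>{0..1}. integral {0..1} (\<lambda>s. \<bar>K t s\<bar>))"

definition DM :: "real \<Rightarrow> real \<Rightarrow> real \<Rightarrow> real \<Rightarrow> (real \<times> real \<times> real \<times> real) set" where
  "DM M0 M1 M2 M = {(t, x, y, z). 0 \<le> t \<and> t \<le> 1 \<and> \<bar>x\<bar> \<le> M0 * M \<and> \<bar>y\<bar> \<le> M1 * M \<and> \<bar>z\<bar> \<le> M2 * M}"

end

theory Submission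
  imports Defs
begin

text \<open>The boundary value problem is turned into a fixed point equation for \<open>\<phi> = u'''\<close> rather than for
  \<open>u\<close>: with \<open>u\<close>, \<open>u'\<close>, \<open>u''\<close> the integrals of \<open>\<phi>\<close> against \<open>G\<close>, \<open>G\<^sub>1\<close>, \<open>G\<^sub>2\<close>, the map
  \<open>\<phi> \<mapsto> f(t, u, u', u'')\<close> sends the ball \<open>\<bar>\<phi>\<bar> \<le> M\<close> of \<open>C[0,1]\<close> to itself and contracts by \<open>q\<close>.
  That the derivatives of \<open>u\<close> are these integrals is not part of the definition of a Green function.
  Unique solvability of the linear problem gives a quadratic polynomial \<open>p\<close> with \<open>B\<^sub>1[p] = B\<^sub>2[p] = 0\<close> and
  \<open>B\<^sub>3[p] = 1\<close>, so that \<open>H(t,s) = [s \<le> t] (t - s)\<^sup>2 / 2 - p(t) k(s)\<close> is an explicit Green function, where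
  \<open>k(s)\<close> is \<open>B\<^sub>3\<close> applied to \<open>t \<mapsto> (t - s)\<^sup>2 / 2\<close>. Since \<open>G\<close> and \<open>H\<close> have the same integrals against
  every continuous \<open>\<phi>\<close>, they and their derivatives agree off a null set.\<close>

section \<open>Functions with vanishing integrals are zero almost everywhere\<close>

text \<open>\<open>h\<close> is only gauge integrable, so integrability of its absolute value has to
  be proved as well. When all interval integrals vanish, the error sum in Henstock's lemma is the
  Riemann sum of the absolute value, which therefore has integral 0.\<close>

lemma negligible_nonzero_of_integral_intervals_zero:
  fixes h :: "real \<Rightarrow> real"
  assumes h: "h integrable_on {a..b}"
    and zero: "\<And>c d. {c..d} \<subseteq> {a..b} \<Longrightarrow> integral {c..d} h = 0"
  shows "negligible {s\<in>{a..b}. h s \<noteq> 0}"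
proof -
  have "((\<lambda>s. \<bar>h s\<bar>) has_integral 0) (cbox a b)"
    unfolding has_integral
  proof (intro allI impI)
    fix e :: real assume "e > 0"
    obtain \<gamma> where \<gamma>: "gauge \<gamma>"
      and less: "\<And>p. \<lbrakk>p tagged_partial_division_of (cbox a b); \<gamma> fine p\<rbrakk> \<Longrightarrow>
             (\<Sum>(x,k)\<in>p. norm (measure lborel k *\<^sub>R h x - integral k h)) < e"
      using Henstock_lemma[of h a b, OF _ \<open>e > 0\<close>] h by auto
    have "norm ((\<Sum>(x, k)\<in>p. measure lborel k *\<^sub>R \<bar>h x\<bar>) - 0) < e"
      if p: "p tagged_division_of cbox a b" "\<gamma> fine p" for p
    proof -
      have eq: "norm (measure lborel k *\<^sub>R h x - integral k h) = measure lborel k *\<^sub>R \<bar>h x\<bar>"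
        if xk: "(x, k) \<in> p" for x k
      proof -
        obtain c d where "k = cbox c d"
          using tagged_division_ofD(4)[OF p(1) xk] by blast
        moreover have "k \<subseteq> cbox a b"
          using tagged_division_ofD(3)[OF p(1) xk] .
        ultimately have "integral k h = 0"
          using zero[of c d] by simp
        then show ?thesis by (simp add: abs_mult)
      qed
      have "(\<Sum>(x, k)\<in>p. measure lborel k *\<^sub>R \<bar>h x\<bar>)
          = (\<Sum>(x,k)\<in>p. norm (measure lborel k *\<^sub>R h x - integral k h))"
        using eq by (intro sum.cong) auto
      also have "\<dots> < e"
        using less p tagged_division_of_def by blast
      finally have "(\<Sum>(x, k)\<in>p. measure lborel k *\<^sub>R \<bar>h x\<bar>) < e" .
      moreover have "(\<Sum>(x, k)\<in>p. measure lborel k *\<^sub>R \<bar>h x\<bar>) \<ge> 0"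
        by (intro sum_nonneg) auto
      ultimately show ?thesis by simp
    qed
    with \<gamma> show "\<exists>\<gamma>. gauge \<gamma> \<and> (\<forall>p. p tagged_division_of cbox a b \<and> \<gamma> fine p \<longrightarrow>
        norm ((\<Sum>(x, k)\<in>p. measure lborel k *\<^sub>R \<bar>h x\<bar>) - 0) < e)"
      by (intro exI[of _ \<gamma>] conjI allI impI) simp_all
  qed
  then have hi: "((\<lambda>s. \<bar>h s\<bar>) has_integral 0) {a..b}" by simp
  \<comment> \<open>Nonnegativity turns gauge integrability into absolute integrability, so the
    Lebesgue integral applies, where a nonnegative function with integral 0 vanishes almost
    everywhere.\<close>
  then have ai: "(\<lambda>s. \<bar>h s\<bar>) absolutely_integrable_on {a..b}"
    by (intro nonnegative_absolutely_integrable_1) auto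
  define k where "k s = indicat_real {a..b} s *\<^sub>R \<bar>h s\<bar>" for s
  have int: "integrable lebesgue k"
    using ai by (simp add: set_integrable_def k_def[abs_def])
  have "(\<integral>s. k s \<partial>lebesgue) = 0"
    using set_lebesgue_integral_eq_integral(2)[OF ai] hi
    by (simp add: set_lebesgue_integral_def k_def[abs_def] integral_unique)
  then have "(\<integral>s. norm (k s) \<partial>lebesgue) = 0"
    by (simp add: k_def[abs_def] abs_mult)
  then have em: "emeasure lebesgue {s\<in>space lebesgue. k s \<noteq> 0} = 0"
    using integral_norm_eq_0_iff[OF int] by blast
  have eq: "{s\<in>space lebesgue. k s \<noteq> 0} = {s\<in>{a..b}. h s \<noteq> 0}"
    by (auto simp: k_def indicator_def)
  have "{s\<in>space lebesgue. k s \<noteq> 0} \<in> sets lebesgue"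
    using borel_measurable_integrable[OF int] by measurable
  with em show ?thesis
    unfolding negligible_iff_null_sets eq by (auto simp: null_sets_def)
qed

text \<open>Gauge integrability of \<open>h\<close> gives no domination for approximating indicators
  by continuous functions. Monotone test functions avoid the difficulty, because the second mean
  value theorem asks only for integrability of \<open>h\<close>; this yields vanishing tail
  integrals and then vanishing interval integrals.\<close>

lemma negligible_nonzero_of_integral_mult_zero:
  fixes h :: "real \<Rightarrow> real"
  assumes h: "h integrable_on {0..1}"
    and zero: "\<And>phi. continuous_on {0..1} phi \<Longrightarrow> ((\<lambda>s. h s * phi s) has_integral 0) {0..1}"
  shows "negligible {s\<in>{0..1}. h s \<noteq> 0}"
proof -
  have sub: "h integrable_on {c..d}" if "{c..d} \<subseteq> {0..1}" for c d
    using h that integrable_on_subinterval by blast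
  have near: "\<exists>c\<in>{x..y}. integral {c..1} h = 0" if xy: "0 \<le> x" "x < y" "y \<le> 1" for x y
  proof -
    \<comment> \<open>The second mean value theorem, for a continuous ramp from 0 to 1, localises the test to \<open>[x,y]\<close>.\<close>
    define g where "g s = max 0 (min 1 ((s - x) / (y - x)))" for s
    have g0: "g s = 0" if "s \<le> x" for s using that xy by (simp add: g_def divide_le_0_iff)
    have g1: "g s = 1" if "s \<ge> y" for s using that xy by (simp add: g_def)
    have gmono: "g s \<le> g s'" if "s \<le> s'" for s s'
      using that xy unfolding g_def
      by (intro max.mono min.mono divide_right_mono) auto
    obtain c where c: "c \<in> {x..y}" and m: "((\<lambda>s. g s * h s) has_integral
        (g x * integral {x..c} h + g y * integral {c..y} h)) {x..y}"
      using second_mean_value_theorem_full[of h x y g] sub[of x y] xy gmono by auto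
    have m: "((\<lambda>s. g s * h s) has_integral integral {c..y} h) {x..y}"
      using m by (simp add: g0 g1)
    have l: "((\<lambda>s. g s * h s) has_integral 0) {0..x}"
      by (rule has_integral_is_0) (simp add: g0)
    have r: "((\<lambda>s. g s * h s) has_integral integral {y..1} h) {y..1}"
      using integrable_integral[OF sub[of y 1]] xy
      by (subst has_integral_cong[of _ _ h]) (auto simp: g1)
    have "((\<lambda>s. g s * h s) has_integral (0 + integral {c..y} h + integral {y..1} h)) {0..1}"
      using has_integral_combine[OF _ _ has_integral_combine[OF _ _ l m] r] xy by simp
    moreover have "continuous_on {0..1} g"
      unfolding g_def using xy by (intro continuous_intros) auto
    from zero[OF this] have "((\<lambda>s. g s * h s) has_integral 0) {0..1}"
      by (simp add: mult.commute)
    ultimately have "integral {c..y} h + integral {y..1} h = 0"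
      using has_integral_unique[of "\<lambda>s. g s * h s"] by (metis add_0)
    moreover have "integral {c..y} h + integral {y..1} h = integral {c..1} h"
      by (rule Henstock_Kurzweil_Integration.integral_combine) (use c xy sub[of c 1] in auto)
    ultimately show ?thesis using c by auto
  qed
  have tail: "integral {x..1} h = 0" if x: "0 \<le> x" "x \<le> 1" for x
  proof (cases "x = 1")
    case False
    \<comment> \<open>\<open>y n\<close> tends to \<open>x\<close> from the right, and
      \<open>Suc n\<close> keeps it at most 1. The points \<open>c n\<close> supplied by
      \<open>near\<close> are squeezed to \<open>x\<close>, and continuity of the indefinite
      integral carries the value 0 to the limit.\<close>
    define y where "y n = x + (1 - x) / real (Suc n)" for n
    have y: "x < y n" "y n \<le> 1" for n
    proof -
      show "x < y n" using False x by (simp add: y_def)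
      have "(1 - x) / real (Suc n) \<le> (1 - x) / 1"
        using x by (intro divide_left_mono) auto
      then show "y n \<le> 1" by (simp add: y_def)
    qed
    have "\<forall>n. \<exists>c. c \<in> {x..y n} \<and> integral {c..1} h = 0"
      using near[OF x(1) y] by blast
    then obtain c where c: "\<And>n. c n \<in> {x..y n}" "\<And>n. integral {c n..1} h = 0" by metis
    have "y \<longlonglongrightarrow> x + 0"
      unfolding y_def[abs_def]
      by (intro tendsto_intros LIMSEQ_Suc[OF lim_const_over_n])
    then have cx: "c \<longlonglongrightarrow> x"
      by (intro tendsto_sandwich[of "\<lambda>_. x" c _ y]) (use c in auto)
    have "c n \<in> {0..1}" for n using c(1)[of n] y[of n] x by auto
    moreover have "continuous_on {0..1} (\<lambda>x. integral {x..1} h)"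
      using indefinite_integral_continuous_1'[OF h] .
    ultimately have "(\<lambda>n. integral {c n..1} h) \<longlonglongrightarrow> integral {x..1} h"
      using cx x continuous_on_tendsto_compose[of "{0..1}" "\<lambda>x. integral {x..1} h" c x sequentially]
      by auto
    then show ?thesis using c(2) by (simp add: LIMSEQ_const_iff)
  qed auto
  show ?thesis
  proof (rule negligible_nonzero_of_integral_intervals_zero[OF h])
    fix c d :: real assume s: "{c..d} \<subseteq> {0..1}"
    show "integral {c..d} h = 0"
    proof (cases "c \<le> d")
      case True
      then have "integral {c..d} h + integral {d..1} h = integral {c..1} h"
        by (intro Henstock_Kurzweil_Integration.integral_combine) (use s sub[of c 1] in auto)
      then show ?thesis using tail s True by auto
    qed auto
  qed
qed

section \<open>Integral operators with kernels bounded in the sense of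
  \<open>max_abs_int\<close>\<close>

text \<open>\<open>integral\<close> and \<open>SUP\<close> are total, so \<open>max_abs_int\<close>
  bounds anything only once the absolute values are integrable and their integrals bounded above;
  both are recorded here.\<close>

definition admissible_kernel :: "(real \<Rightarrow> real \<Rightarrow> real) \<Rightarrow> bool" where
  "admissible_kernel K \<longleftrightarrow>
     (\<forall>t\<in>{0..1}. (\<forall>phi. continuous_on {0..1} phi \<longrightarrow> (\<lambda>s. K t s * phi s) integrable_on {0..1}) \<and>
                 (\<lambda>s. \<bar>K t s\<bar>) integrable_on {0..1}) \<and>
     bdd_above ((\<lambda>t. integral {0..1} (\<lambda>s. \<bar>K t s\<bar>)) ` {0..1})"

lemma admissible_kernelD:
  assumes "admissible_kernel K" "t \<in> {0..1}"
  shows "continuous_on {0..1} phi \<Longrightarrow> (\<lambda>s. K t s * phi s) integrable_on {0..1}"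
    and "(\<lambda>s. \<bar>K t s\<bar>) integrable_on {0..1}"
    and "integral {0..1} (\<lambda>s. \<bar>K t s\<bar>) \<le> max_abs_int K"
  using assms unfolding admissible_kernel_def max_abs_int_def by (auto intro: cSUP_upper)

lemma max_abs_int_nonneg: "admissible_kernel K \<Longrightarrow> 0 \<le> max_abs_int K"
  using admissible_kernelD(3)[of K 0] integral_nonneg[OF admissible_kernelD(2)[of K 0]] by force

lemma admissible_kernel_integral_bound:
  assumes K: "admissible_kernel K" and t: "t \<in> {0..1}"
    and phi: "continuous_on {0..1} phi" "\<And>s. s \<in> {0..1} \<Longrightarrow> \<bar>phi s\<bar> \<le> C"
  shows "\<bar>integral {0..1} (\<lambda>s. K t s * phi s)\<bar> \<le> max_abs_int K * C"
proof -
  have C: "0 \<le> C" using phi(2)[of 0] by auto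
  have "norm (integral {0..1} (\<lambda>s. K t s * phi s)) \<le> integral {0..1} (\<lambda>s. \<bar>K t s\<bar> * C)"
  proof (rule integral_norm_bound_integral)
    show "(\<lambda>s. \<bar>K t s\<bar> * C) integrable_on {0..1}"
      using admissible_kernelD(2)[OF K t] by (rule integrable_on_mult_left)
    show "norm (K t s * phi s) \<le> \<bar>K t s\<bar> * C" if "s \<in> {0..1}" for s
      using phi(2)[OF that] by (simp add: abs_mult mult_left_mono)
  qed (rule admissible_kernelD(1)[OF K t phi(1)])
  also have "\<dots> = integral {0..1} (\<lambda>s. \<bar>K t s\<bar>) * C" by simp
  also have "\<dots> \<le> max_abs_int K * C"
    using admissible_kernelD(3)[OF K t] C by (rule mult_right_mono)
  finally show ?thesis by simp
qed

lemma admissible_kernel_integral_diff_bound: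
  assumes K: "admissible_kernel K" and t: "t \<in> {0..1}"
    and phi: "continuous_on {0..1} phi" and psi: "continuous_on {0..1} psi"
    and le: "\<And>s. s \<in> {0..1} \<Longrightarrow> \<bar>phi s - psi s\<bar> \<le> C"
  shows "\<bar>integral {0..1} (\<lambda>s. K t s * phi s) - integral {0..1} (\<lambda>s. K t s * psi s)\<bar>
           \<le> max_abs_int K * C"
proof -
  have "integral {0..1} (\<lambda>s. K t s * (phi s - psi s))
      = integral {0..1} (\<lambda>s. K t s * phi s) - integral {0..1} (\<lambda>s. K t s * psi s)"
    unfolding right_diff_distrib
    by (intro Henstock_Kurzweil_Integration.integral_diff admissible_kernelD(1)[OF K t] phi psi)
  then show ?thesis
    using admissible_kernel_integral_bound[OF K t continuous_on_diff[OF phi psi] le] by simp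
qed

text \<open>Each integral involved has \<open>t\<close> fixed and ignores null sets, so the
  exceptional set may vary with \<open>t\<close>. This carries results from the explicit kernels to
  \<open>G\<close>, \<open>G1\<close> and \<open>G2\<close>.\<close>

lemma admissible_kernel_cong_ae:
  assumes K: "admissible_kernel K"
    and N: "\<And>t. t \<in> {0..1} \<Longrightarrow> negligible (N t)"
    and eq: "\<And>t s. \<lbrakk>t \<in> {0..1}; s \<in> {0..1} - N t\<rbrakk> \<Longrightarrow> K' t s = K t s"
  shows "admissible_kernel K'"
    and "t \<in> {0..1} \<Longrightarrow>
      integral {0..1} (\<lambda>s. K' t s * phi s) = integral {0..1} (\<lambda>s. K t s * phi s)"
proof -
  show "integral {0..1} (\<lambda>s. K' t s * phi s) = integral {0..1} (\<lambda>s. K t s * phi s)"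
    if "t \<in> {0..1}" for t phi
    using eq[OF that] by (intro integral_spike[OF N[OF that]]) auto
  have a: "integral {0..1} (\<lambda>s. \<bar>K' t s\<bar>) = integral {0..1} (\<lambda>s. \<bar>K t s\<bar>)"
    if "t \<in> {0..1}" for t
    using eq[OF that] by (intro integral_spike[OF N[OF that]]) auto
  have "(\<lambda>s. K' t s * phi s) integrable_on {0..1}"
    if "t \<in> {0..1}" "continuous_on {0..1} phi" for t phi
    using eq[OF that(1)]
    by (intro integrable_spike[OF admissible_kernelD(1)[OF K that] N[OF that(1)]]) auto
  moreover have "(\<lambda>s. \<bar>K' t s\<bar>) integrable_on {0..1}" if "t \<in> {0..1}" for t
    using eq[OF that]
    by (intro integrable_spike[OF admissible_kernelD(2)[OF K that] N[OF that]]) auto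
  ultimately show "admissible_kernel K'"
    using K a unfolding admissible_kernel_def by (simp cong: image_cong_simp)
qed

lemma has_integral_piecewise_continuous:
  fixes g h :: "real \<Rightarrow> real"
  assumes t: "t \<in> {0..1}" and g: "continuous_on {0..1} g" and h: "continuous_on {0..1} h"
  shows "((\<lambda>s. if s \<le> t then g s else h s) has_integral
           (integral {0..t} g + integral {t..1} h)) {0..1}"
proof (rule has_integral_combine[of 0 t 1])
  have "(g has_integral integral {0..t} g) {0..t}"
    using t g by (intro integrable_integral integrable_continuous_real) (auto elim: continuous_on_subset)
  then show "((\<lambda>s. if s \<le> t then g s else h s) has_integral integral {0..t} g) {0..t}"
    by (rule has_integral_eq[rotated]) auto
  have "(h has_integral integral {t..1} h) {t..1}"
    using t h by (intro integrable_integral integrable_continuous_real) (auto elim: continuous_on_subset)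
  \<comment> \<open>On \<open>{t..1}\<close> the integrand differs from \<open>h\<close> at most at
    the single point \<open>t\<close>.\<close>
  then show "((\<lambda>s. if s \<le> t then g s else h s) has_integral integral {t..1} h) {t..1}"
    by (rule has_integral_spike_finite[of "{t}", rotated -1]) auto
qed (use t in auto)

lemma admissible_kernel_piecewise:
  assumes w: "\<And>t. t \<in> {0..1} \<Longrightarrow> continuous_on {0..1} (w t)"
    and z: "\<And>t. t \<in> {0..1} \<Longrightarrow> continuous_on {0..1} (z t)"
    and bound: "\<And>t s. \<lbrakk>t \<in> {0..1}; s \<in> {0..1}\<rbrakk> \<Longrightarrow> \<bar>w t s\<bar> \<le> B \<and> \<bar>z t s\<bar> \<le> B"
  shows "admissible_kernel (\<lambda>t s. if s \<le> t then w t s else z t s)"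
  unfolding admissible_kernel_def
proof (intro conjI ballI allI impI)
  fix t :: real assume t: "t \<in> {0..1}"
  show "(\<lambda>s. (if s \<le> t then w t s else z t s) * phi s) integrable_on {0..1}"
    if "continuous_on {0..1} phi" for phi
  proof -
    have "(\<lambda>s. if s \<le> t then w t s * phi s else z t s * phi s) integrable_on {0..1}"
      using has_integral_piecewise_continuous[OF t continuous_on_mult[OF w[OF t] that]
          continuous_on_mult[OF z[OF t] that]] by blast
    then show ?thesis by (rule integrable_eq) auto
  qed
  have "(\<lambda>s. if s \<le> t then \<bar>w t s\<bar> else \<bar>z t s\<bar>) integrable_on {0..1}"
    using has_integral_piecewise_continuous[OF t continuous_on_rabs[OF w[OF t]]
        continuous_on_rabs[OF z[OF t]]] by blast
  then show "(\<lambda>s. \<bar>if s \<le> t then w t s else z t s\<bar>) integrable_on {0..1}"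
    by (rule integrable_eq) auto
next
  have "integral {0..1} (\<lambda>s. \<bar>if s \<le> t then w t s else z t s\<bar>) \<le> B" if t: "t \<in> {0..1}" for t
  proof -
    have "norm (integral {0..1} (\<lambda>s. \<bar>if s \<le> t then w t s else z t s\<bar>)) \<le> integral {0..1} (\<lambda>s::real. B)"
    proof (rule integral_norm_bound_integral)
      have "(\<lambda>s. if s \<le> t then \<bar>w t s\<bar> else \<bar>z t s\<bar>) integrable_on {0..1}"
        using has_integral_piecewise_continuous[OF t continuous_on_rabs[OF w[OF t]]
            continuous_on_rabs[OF z[OF t]]] by blast
      then show "(\<lambda>s. \<bar>if s \<le> t then w t s else z t s\<bar>) integrable_on {0..1}"
        by (rule integrable_eq) auto
    qed (use bound[OF t] in auto)
    then show ?thesis by simp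
  qed
  then show "bdd_above ((\<lambda>t. integral {0..1} (\<lambda>s. \<bar>if s \<le> t then w t s else z t s\<bar>)) ` {0..1})"
    by (rule bdd_aboveI2)
qed

section \<open>Moments and kernels quadratic in \<open>s\<close>\<close>

text \<open>Expanding the Volterra kernels \<open>(t - s)\<^sup>2 / 2\<close>, \<open>t - s\<close>, \<open>1\<close> in powers of \<open>s\<close>
  reduces their differentiation in \<open>t\<close> to the fundamental theorem of calculus.\<close>

definition moment :: "(real \<Rightarrow> real) \<Rightarrow> nat \<Rightarrow> real \<Rightarrow> real" where
  "moment phi j t = integral {0..t} (\<lambda>s. s ^ j * phi s)"

lemma moment_0 [simp]: "moment phi j 0 = 0"
  by (simp add: moment_def)

lemma has_derivative_moment [derivative_intros]:
  assumes "continuous_on {0..1} phi" "t \<in> {0..1}"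
  shows "(moment phi j has_real_derivative t ^ j * phi t) (at t within {0..1})"
  unfolding moment_def[abs_def] using assms
  by (intro integral_has_real_derivative continuous_intros)

lemma moment_has_integral:
  assumes "continuous_on {0..1} phi" "t \<in> {0..1}"
  shows "((\<lambda>s. s ^ j * phi s) has_integral moment phi j t) {0..t}"
  unfolding moment_def using assms
  by (intro integrable_integral integrable_continuous_real continuous_intros)
     (auto elim: continuous_on_subset)

lemma integral_quadratic_moment:
  assumes "continuous_on {0..1} phi" "t \<in> {0..1}"
  shows "integral {0..t} (\<lambda>s. (e0 + e1 * s + e2 * s\<^sup>2) * phi s)
       = e0 * moment phi 0 t + e1 * moment phi 1 t + e2 * moment phi 2 t"
proof -
  have "((\<lambda>s. e0 * (s ^ 0 * phi s) + e1 * (s ^ 1 * phi s) + e2 * (s ^ 2 * phi s)) has_integral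
      (e0 * moment phi 0 t + e1 * moment phi 1 t + e2 * moment phi 2 t)) {0..t}"
    by (intro has_integral_add has_integral_mult_right moment_has_integral assms)
  then show ?thesis
    by (intro integral_unique, rule has_integral_eq[rotated]) (auto simp: algebra_simps)
qed

text \<open>The common shape of the three explicit kernels: a Volterra part minus a rank-one
  correction. As \<open>t\<close> is fixed, its functions enter as the constants \<open>e0\<close>,
  \<open>e1\<close>, \<open>e2\<close> and \<open>P\<close>.\<close>

lemma integral_quadratic_kernel:
  assumes phi: "continuous_on {0..1} phi" and t: "t \<in> {0..1}"
  shows "integral {0..1} (\<lambda>s. (if s \<le> t then e0 + e1 * s + e2 * s\<^sup>2 - P * (r0 + r1 * s + r2 * s\<^sup>2)
                                  else - (P * (r0 + r1 * s + r2 * s\<^sup>2))) * phi s)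
       = e0 * moment phi 0 t + e1 * moment phi 1 t + e2 * moment phi 2 t
         - P * (r0 * moment phi 0 1 + r1 * moment phi 1 1 + r2 * moment phi 2 1)"
proof -
  define k where "k s = (r0 + r1 * s + r2 * s\<^sup>2) * phi s" for s
  define w where "w s = (e0 + e1 * s + e2 * s\<^sup>2) * phi s" for s
  have k: "continuous_on {0..1} k" and w: "continuous_on {0..1} w"
    unfolding k_def[abs_def] w_def[abs_def] using phi by (intro continuous_intros; simp)+
  have W: "((\<lambda>s. if s \<le> t then w s else 0) has_integral (integral {0..t} w + integral {t..1} (\<lambda>_. 0))) {0..1}"
    by (rule has_integral_piecewise_continuous[OF t w]) simp
  have K: "((\<lambda>s. P * k s) has_integral P * integral {0..1} k) {0..1}"
    by (intro has_integral_mult_right integrable_integral integrable_continuous_real k)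
  have "((\<lambda>s. (if s \<le> t then w s else 0) - P * k s) has_integral
      (integral {0..t} w - P * integral {0..1} k)) {0..1}"
    using has_integral_diff[OF W K] by simp
  moreover have "integral {0..t} w = e0 * moment phi 0 t + e1 * moment phi 1 t + e2 * moment phi 2 t"
    unfolding w_def by (rule integral_quadratic_moment[OF phi t])
  moreover have "integral {0..1} k = r0 * moment phi 0 1 + r1 * moment phi 1 1 + r2 * moment phi 2 1"
    unfolding k_def by (rule integral_quadratic_moment[OF phi]) simp
  moreover have "(\<lambda>s. (if s \<le> t then w s else 0) - P * k s)
      = (\<lambda>s. (if s \<le> t then e0 + e1 * s + e2 * s\<^sup>2 - P * (r0 + r1 * s + r2 * s\<^sup>2)
                else - (P * (r0 + r1 * s + r2 * s\<^sup>2))) * phi s)"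
    by (auto simp: w_def k_def left_diff_distrib)
  ultimately show ?thesis
    by (metis integral_unique)
qed

section \<open>The linear boundary value problem and its explicit solution\<close>

lemma deriv3_on01_cong:
  assumes "deriv3_on01 u u1 u2 u3"
    and "\<And>t. t \<in> {0..1} \<Longrightarrow> v t = u t \<and> v1 t = u1 t \<and> v2 t = u2 t \<and> v3 t = u3 t"
  shows "deriv3_on01 v v1 v2 v3"
  unfolding deriv3_on01_def
proof (intro conjI ballI)
  fix t :: real assume t: "t \<in> {0..1}"
  show "(v has_real_derivative v1 t) (at t within {0..1})"
    using has_field_derivative_transform_within[of u "u1 t" t "{0..1}" 1 v] assms t
    by (simp add: deriv3_on01_def)
  show "(v1 has_real_derivative v2 t) (at t within {0..1})"
    using has_field_derivative_transform_within[of u1 "u2 t" t "{0..1}" 1 v1] assms t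
    by (simp add: deriv3_on01_def)
next
  fix t :: real assume t: "t \<in> {0<..<1}"
  show "(v2 has_real_derivative v3 t) (at t)"
    using has_field_derivative_transform_within_open[of u2 "u3 t" t "{0<..<1}" v2] assms t
    by (simp add: deriv3_on01_def)
qed

lemma at_within_01_neq_bot: "t \<in> {0..1} \<Longrightarrow> at t within {0..1::real} \<noteq> bot"
  by (simp add: trivial_limit_within )

lemma green_functionD:
  assumes "is_green_fun a1 b1 c1 a2 b2 c2 a3 b3 c3 G" "continuous_on {0..1} phi" "t \<in> {0..1}"
  shows "(\<lambda>s. G t s * phi s) integrable_on {0..1}"
    and "lin_sol a1 b1 c1 a2 b2 c2 a3 b3 c3 phi u \<Longrightarrow> u t = integral {0..1} (\<lambda>s. G t s * phi s)"
  using assms unfolding is_green_fun_def by blast+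

text \<open>The numbers are the values at 0 of \<open>p\<close>, \<open>p'\<close> and
  \<open>p''\<close>. A quadratic with zero boundary values solves the problem with right-hand side
  0, so uniqueness makes it vanish; the boundary map on quadratics is then injective, hence
  surjective by dimension.\<close>

lemma green_function_boundary_dual:
  assumes green: "is_green_fun a1 b1 c1 a2 b2 c2 a3 b3 c3 G"
  obtains d0 d1 d2 :: real where
    "a1 * d0 + b1 * d1 + c1 * d2 = 0"
    "a2 * d0 + b2 * d1 + c2 * d2 = 0"
    "a3 * (d0 + d1 + d2 / 2) + b3 * (d1 + d2) + c3 * d2 = 1"
proof -
  \<comment> \<open>\<open>F\<close> sends the quadratic \<open>x + y * t + z * t^2 / 2\<close> to
    its three boundary values.\<close>
  define F where "F = (\<lambda>(x, y, z). (a1 * x + b1 * y + c1 * z, a2 * x + b2 * y + c2 * z,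
     a3 * (x + y + z / 2) + b3 * (y + z) + c3 * z))"
  have lin: "linear F"
    by (rule linearI) (auto simp: F_def algebra_simps add_divide_distrib)
  moreover have "inj F"
  proof (subst linear_injective_0[OF lin], intro allI impI)
    fix v assume 0: "F v = 0"
    obtain x y z where v: "v = (x, y, z)" by (metis prod.exhaust)
    let ?u = "\<lambda>t. x + y * t + z * t\<^sup>2 / 2"
    have "lin_sol a1 b1 c1 a2 b2 c2 a3 b3 c3 (\<lambda>_. 0) ?u"
      unfolding lin_sol_def
    proof (intro exI conjI)
      show "deriv3_on01 ?u (\<lambda>t. y + z * t) (\<lambda>t. z) (\<lambda>_. 0)"
        unfolding deriv3_on01_def by (auto intro!: derivative_eq_intros)
      show "bcs a1 b1 c1 a2 b2 c2 a3 b3 c3 ?u (\<lambda>t. y + z * t) (\<lambda>t. z)"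
        using 0 by (simp add: v F_def bcs_def zero_prod_def)
    qed
    then have u0: "?u t = 0" if "t \<in> {0..1}" for t
      using green_functionD(2)[OF green _ that, of "\<lambda>_. 0" ?u] by simp
    \<comment> \<open>A quadratic vanishing at three points is zero.\<close>
    from u0[of 0] u0[of 1] u0[of "1/2"] show "v = 0"
      by (simp add: v zero_prod_def power2_eq_square)
  qed
  ultimately have "surj F" by (rule linear_injective_imp_surjective) simp
  then obtain v where "F v = (0, 0, 1)" by (metis surjD)
  then show ?thesis
    using that by (cases v) (auto simp: F_def)
qed

text \<open>The Volterra part has zero data at 0 because all moments vanish there, and
  \<open>C\<close> is its third boundary value; subtracting \<open>C\<close> times the quadratic
  with boundary values 0, 0, 1 corrects it. The padded terms such as
  \<open>0 * moment phi 2 t\<close> match the right-hand side of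
  \<open>integral_quadratic_kernel\<close>.\<close>

lemma explicit_solution:
  assumes phi: "continuous_on {0..1} phi"
    and d: "a1 * d0 + b1 * d1 + c1 * d2 = 0" "a2 * d0 + b2 * d1 + c2 * d2 = 0"
      "a3 * (d0 + d1 + d2 / 2) + b3 * (d1 + d2) + c3 * d2 = 1"
    and C: "C = (a3 / 2 + b3 + c3) * moment phi 0 1 + - (a3 + b3) * moment phi 1 1
                + a3 / 2 * moment phi 2 1"
    and u: "\<And>t. t \<in> {0..1} \<Longrightarrow> u t = t\<^sup>2 / 2 * moment phi 0 t + - t * moment phi 1 t
              + 1 / 2 * moment phi 2 t - (d0 + d1 * t + d2 * t\<^sup>2 / 2) * C"
    and u1: "\<And>t. t \<in> {0..1} \<Longrightarrow> u1 t = t * moment phi 0 t + - 1 * moment phi 1 t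
              + 0 * moment phi 2 t - (d1 + d2 * t) * C"
    and u2: "\<And>t. t \<in> {0..1} \<Longrightarrow> u2 t = 1 * moment phi 0 t + 0 * moment phi 1 t
              + 0 * moment phi 2 t - d2 * C"
  shows "deriv3_on01 u u1 u2 phi" and "bcs a1 b1 c1 a2 b2 c2 a3 b3 c3 u u1 u2"
proof -
  have d2': "((\<lambda>t. moment phi 0 t - d2 * C) has_real_derivative phi t) (at t within {0..1})"
    if t: "t \<in> {0..1}" for t
    by (rule derivative_eq_intros phi t refl | simp)+
  have "((\<lambda>t. moment phi 0 t - d2 * C) has_real_derivative phi t) (at t)"
    if t: "t \<in> {0<..<1}" for t
    using d2'[of t] t by (simp add: at_within_Icc_at)
  moreover have "((\<lambda>t. t * moment phi 0 t - moment phi 1 t - (d1 + d2 * t) * C) has_real_derivative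
      moment phi 0 t - d2 * C) (at t within {0..1})" if t: "t \<in> {0..1}" for t
    by (rule derivative_eq_intros phi t refl | simp)+
  \<comment> \<open>The terms with \<open>phi t\<close> coming from the moments cancel, since
    \<open>t^2 / 2 - t * t + t^2 / 2 = 0\<close>.\<close>
  moreover have "((\<lambda>t. t\<^sup>2 / 2 * moment phi 0 t - t * moment phi 1 t + moment phi 2 t / 2
      - (d0 + d1 * t + d2 * t\<^sup>2 / 2) * C) has_real_derivative
      t * moment phi 0 t - moment phi 1 t - (d1 + d2 * t) * C) (at t within {0..1})"
    if t: "t \<in> {0..1}" for t
    by (rule derivative_eq_intros phi t refl | simp add: power2_eq_square algebra_simps)+
  ultimately have "deriv3_on01
      (\<lambda>t. t\<^sup>2 / 2 * moment phi 0 t - t * moment phi 1 t + moment phi 2 t / 2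
        - (d0 + d1 * t + d2 * t\<^sup>2 / 2) * C)
      (\<lambda>t. t * moment phi 0 t - moment phi 1 t - (d1 + d2 * t) * C)
      (\<lambda>t. moment phi 0 t - d2 * C) phi"
    unfolding deriv3_on01_def by auto
  then show "deriv3_on01 u u1 u2 phi"
    by (rule deriv3_on01_cong) (simp add: u u1 u2)
  have v0: "u 0 = - C * d0" "u1 0 = - C * d1" "u2 0 = - C * d2"
    by (simp_all add: u u1 u2)
  have "a1 * u 0 + b1 * u1 0 + c1 * u2 0 = - C * (a1 * d0 + b1 * d1 + c1 * d2)"
    "a2 * u 0 + b2 * u1 0 + c2 * u2 0 = - C * (a2 * d0 + b2 * d1 + c2 * d2)"
    unfolding v0 by (simp_all add: algebra_simps)
  moreover have "a3 * u 1 + b3 * u1 1 + c3 * u2 1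
      = ((a3 / 2 + b3 + c3) * moment phi 0 1 + - (a3 + b3) * moment phi 1 1 + a3 / 2 * moment phi 2 1)
        - C * (a3 * (d0 + d1 + d2 / 2) + b3 * (d1 + d2) + c3 * d2)"
    by (simp add: u u1 u2 algebra_simps add_divide_distrib)
  moreover note C[symmetric]
  ultimately show "bcs a1 b1 c1 a2 b2 c2 a3 b3 c3 u u1 u2"
    by (simp add: bcs_def d)
qed

section \<open>Identifying the given Green function with the explicit one\<close>

lemma continuous_zero_of_dense:
  fixes h :: "real \<Rightarrow> real"
  assumes T: "T \<subseteq> S" "S \<subseteq> closure T" and x: "x \<in> S"
    and cont: "continuous (at x within S) h"
    and zero: "\<And>y. y \<in> T \<Longrightarrow> h y = 0"
  shows "h x = 0"
proof -
  obtain y where y: "\<And>n. y n \<in> T" "y \<longlonglongrightarrow> x"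
    using T(2) x closure_sequential by blast
  then have "(\<lambda>n. h (y n)) \<longlonglongrightarrow> h x"
    using cont T(1) unfolding continuous_within_sequentially comp_def by blast
  then show ?thesis
    using y(1) zero by (simp add: LIMSEQ_const_iff)
qed

text \<open>The ball of radius \<open>\<bar>t - s\<bar>\<close> around \<open>t\<close> misses
  \<open>s\<close>, so agreement off \<open>s\<close> is agreement near \<open>t\<close>.\<close>

lemma derivative_eq_off_diagonal:
  fixes F F' D D' :: "real \<Rightarrow> real"
  assumes t: "t \<in> {0..1}" "t \<noteq> s"
    and D: "(F has_real_derivative D t) (at t within {0..1})"
    and D': "(F' has_real_derivative D' t) (at t within {0..1})"
    and eq: "\<And>r. \<lbrakk>r \<in> {0..1}; r \<noteq> s\<rbrakk> \<Longrightarrow> F r = F' r"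
  shows "D t = D' t"
proof -
  have "(F' has_real_derivative D t) (at t within {0..1})"
    by (rule has_field_derivative_transform_within[OF D, of "\<bar>t - s\<bar>"])
       (use t eq in \<open>auto simp: dist_real_def\<close>)
  then show ?thesis
    using has_field_derivative_unique D' at_within_01_neq_bot[OF t(1)] by blast
qed

text \<open>\<open>is_green_fun\<close> determines \<open>G t\<close> only up to a null set depending on \<open>t\<close>; continuity in \<open>t\<close>
  off the diagonal makes the null set uniform, which is what lets the identity be differentiated.\<close>

lemma kernels_eq_ae:
  assumes G: "\<And>t s. t \<in> {0..1} \<Longrightarrow> s \<in> {0..1} \<Longrightarrow> t \<noteq> s \<Longrightarrow>
      ((\<lambda>r. G r s) has_real_derivative G1 t s) (at t within {0..1})"
    and G1: "\<And>t s. t \<in> {0..1} \<Longrightarrow> s \<in> {0..1} \<Longrightarrow> t \<noteq> s \<Longrightarrow>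
      ((\<lambda>r. G1 r s) has_real_derivative G2 t s) (at t within {0..1})"
    and H: "\<And>t s. t \<in> {0..1} \<Longrightarrow> s \<in> {0..1} \<Longrightarrow> t \<noteq> s \<Longrightarrow>
      ((\<lambda>r. H r s) has_real_derivative H1 t s) (at t within {0..1})"
    and H1: "\<And>t s. t \<in> {0..1} \<Longrightarrow> s \<in> {0..1} \<Longrightarrow> t \<noteq> s \<Longrightarrow>
      ((\<lambda>r. H1 r s) has_real_derivative H2 t s) (at t within {0..1})"
    and ae: "\<And>t. t \<in> {0..1} \<Longrightarrow> negligible {s\<in>{0..1}. G t s - H t s \<noteq> 0}"
  obtains N where "negligible N"
    "\<And>t s. \<lbrakk>t \<in> {0..1}; s \<in> {0..1} - (insert t N)\<rbrakk> \<Longrightarrow> G t s = H t s \<and> G1 t s = H1 t s \<and> G2 t s = H2 t s"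
proof -
  obtain T :: "real set" where T: "countable T" "T \<subseteq> {0..1}" "{0..1} \<subseteq> closure T"
    using separable by blast
  \<comment> \<open>Countability of \<open>T\<close> keeps the union negligible, and it no longer
    depends on \<open>t\<close>.\<close>
  define N where "N = (\<Union>t\<in>T. {s\<in>{0..1}. G t s - H t s \<noteq> 0})"
  have "negligible N"
    unfolding N_def using T(1,2) ae by (intro negligible_countable_Union) auto
  moreover have "G t s = H t s \<and> G1 t s = H1 t s \<and> G2 t s = H2 t s"
    if t: "t \<in> {0..1}" and s: "s \<in> {0..1} - (insert t N)" for t s
  proof -
    have s': "s \<in> {0..1}" "s \<noteq> t" using s by auto
    have 0: "G r s = H r s" if r: "r \<in> {0..1}" "r \<noteq> s" for r
    proof -
      have "continuous (at r within {0..1}) (\<lambda>r. G r s - H r s)"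
        using DERIV_continuous[OF G[OF r(1) s'(1) r(2)]] DERIV_continuous[OF H[OF r(1) s'(1) r(2)]]
        by (rule continuous_diff)
      \<comment> \<open>For \<open>s\<close> outside \<open>N\<close> the difference vanishes at
        every point of \<open>T\<close>, even at \<open>s\<close> if it lies there; continuity is
        used only at \<open>r\<close>, which is off the diagonal.\<close>
      then have "G r s - H r s = 0"
        by (rule continuous_zero_of_dense[OF T(2,3) r(1)]) (use s in \<open>auto simp: N_def\<close>)
      then show ?thesis by simp
    qed
    have 1: "G1 r s = H1 r s" if r: "r \<in> {0..1}" "r \<noteq> s" for r
      by (rule derivative_eq_off_diagonal[of r s "\<lambda>r. G r s" "\<lambda>r. G1 r s" "\<lambda>r. H r s" "\<lambda>r. H1 r s"])
         (use r s' 0 G H in auto)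
    have 2: "G2 r s = H2 r s" if r: "r \<in> {0..1}" "r \<noteq> s" for r
      by (rule derivative_eq_off_diagonal[of r s "\<lambda>r. G1 r s" "\<lambda>r. G2 r s" "\<lambda>r. H1 r s" "\<lambda>r. H2 r s"])
         (use r s' 1 G1 H1 in auto)
    show ?thesis using 0 1 2 t s' by auto
  qed
  ultimately show ?thesis using that by blast
qed

text \<open>Continuous coefficients are bounded on the compact interval, and powers of
  \<open>s\<close> are at most 1. \<open>e2\<close> is a constant because it is 1/2, 0 and 0 in the
  three kernels to which this applies.\<close>

lemma admissible_quadratic_kernel:
  assumes e: "continuous_on {0..1} e0" "continuous_on {0..1} e1" "continuous_on {0..1} P"
  shows "admissible_kernel (\<lambda>t s. if s \<le> t then e0 t + e1 t * s + e2 * s\<^sup>2 - P t * (r0 + r1 * s + r2 * s\<^sup>2)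
                                  else - (P t * (r0 + r1 * s + r2 * s\<^sup>2)))"
proof -
  have "\<exists>B. \<forall>x\<in>{0..1::real}. \<bar>g x\<bar> \<le> B" if "continuous_on {0..1} g" for g :: "real \<Rightarrow> real"
    using compact_imp_bounded[OF compact_continuous_image[OF that compact_Icc]]
    by (auto simp: bounded_iff)
  then obtain E0 E1 B where E: "\<And>x. x \<in> {0..1} \<Longrightarrow> \<bar>e0 x\<bar> \<le> E0" "\<And>x. x \<in> {0..1} \<Longrightarrow> \<bar>e1 x\<bar> \<le> E1"
    "\<And>x. x \<in> {0..1} \<Longrightarrow> \<bar>P x\<bar> \<le> B"
    using e by metis
  have quad: "\<bar>x + y * s + z * s\<^sup>2\<bar> \<le> \<bar>x\<bar> + \<bar>y\<bar> + \<bar>z\<bar>" if s: "s \<in> {0..1}" for x y z s :: real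
  proof -
    have "s\<^sup>2 \<le> 1" "0 \<le> s" "s \<le> 1" using s by (auto simp: power_le_one)
    then have "\<bar>y * s\<bar> \<le> \<bar>y\<bar>" "\<bar>z * s\<^sup>2\<bar> \<le> \<bar>z\<bar>"
      by (auto simp: abs_mult intro: mult_left_le)
    then show ?thesis by linarith
  qed
  show ?thesis
  proof (rule admissible_kernel_piecewise[where B = "E0 + E1 + \<bar>e2\<bar> + B * (\<bar>r0\<bar> + \<bar>r1\<bar> + \<bar>r2\<bar>)"])
    fix t s :: real assume t: "t \<in> {0..1}" and s: "s \<in> {0..1}"
    have "\<bar>e0 t + e1 t * s + e2 * s\<^sup>2\<bar> \<le> E0 + E1 + \<bar>e2\<bar>"
      using quad[OF s, of "e0 t" "e1 t" e2] E(1,2)[OF t] by linarith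
    moreover have "\<bar>P t * (r0 + r1 * s + r2 * s\<^sup>2)\<bar> \<le> B * (\<bar>r0\<bar> + \<bar>r1\<bar> + \<bar>r2\<bar>)"
      unfolding abs_mult using E(3)[OF t] quad[OF s] by (intro mult_mono) auto
    ultimately show "\<bar>e0 t + e1 t * s + e2 * s\<^sup>2 - P t * (r0 + r1 * s + r2 * s\<^sup>2)\<bar>
          \<le> E0 + E1 + \<bar>e2\<bar> + B * (\<bar>r0\<bar> + \<bar>r1\<bar> + \<bar>r2\<bar>) \<and>
        \<bar>- (P t * (r0 + r1 * s + r2 * s\<^sup>2))\<bar> \<le> E0 + E1 + \<bar>e2\<bar> + B * (\<bar>r0\<bar> + \<bar>r1\<bar> + \<bar>r2\<bar>)"
      by (intro conjI order_trans[OF abs_triangle_ineq4]) linarith+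
  qed (intro continuous_intros)+
qed

text \<open>All claims are computed for the explicit kernels \<open>H\<close>, \<open>H1\<close>,
  \<open>H2\<close> and transferred, which justifies differentiating under the integral sign without
  regularity of \<open>G1\<close> and \<open>G2\<close> in \<open>s\<close>.\<close>

lemma green_function_kernels:
  assumes green: "is_green_fun a1 b1 c1 a2 b2 c2 a3 b3 c3 G"
    and G1: "\<And>t s. t \<in> {0..1} \<Longrightarrow> s \<in> {0..1} \<Longrightarrow> t \<noteq> s \<Longrightarrow>
               ((\<lambda>r. G r s) has_real_derivative G1 t s) (at t within {0..1})"
    and G2: "\<And>t s. t \<in> {0..1} \<Longrightarrow> s \<in> {0..1} \<Longrightarrow> t \<noteq> s \<Longrightarrow>
               ((\<lambda>r. G1 r s) has_real_derivative G2 t s) (at t within {0..1})"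
  shows "admissible_kernel G" "admissible_kernel G1" "admissible_kernel G2"
    and "\<And>phi. continuous_on {0..1} phi \<Longrightarrow>
      deriv3_on01 (\<lambda>t. integral {0..1} (\<lambda>s. G t s * phi s)) (\<lambda>t. integral {0..1} (\<lambda>s. G1 t s * phi s))
        (\<lambda>t. integral {0..1} (\<lambda>s. G2 t s * phi s)) phi \<and>
      bcs a1 b1 c1 a2 b2 c2 a3 b3 c3 (\<lambda>t. integral {0..1} (\<lambda>s. G t s * phi s))
        (\<lambda>t. integral {0..1} (\<lambda>s. G1 t s * phi s)) (\<lambda>t. integral {0..1} (\<lambda>s. G2 t s * phi s))"
proof -
  obtain d0 d1 d2 where d: "a1 * d0 + b1 * d1 + c1 * d2 = 0" "a2 * d0 + b2 * d1 + c2 * d2 = 0"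
    "a3 * (d0 + d1 + d2 / 2) + b3 * (d1 + d2) + c3 * d2 = 1"
    using green_function_boundary_dual[OF green] .
  \<comment> \<open>The coefficients of \<open>a3 * (1 - s)^2 / 2 + b3 * (1 - s) + c3\<close> in
    powers of \<open>s\<close>.\<close>
  let ?r0 = "a3 / 2 + b3 + c3" and ?r1 = "- (a3 + b3)" and ?r2 = "a3 / 2"
  define k where "k s = ?r0 + ?r1 * s + ?r2 * s\<^sup>2" for s
  define H where "H t s = (if s \<le> t then t\<^sup>2 / 2 + - t * s + 1 / 2 * s\<^sup>2 - (d0 + d1 * t + d2 * t\<^sup>2 / 2) * k s
    else - ((d0 + d1 * t + d2 * t\<^sup>2 / 2) * k s))" for t s
  define H1 where "H1 t s = (if s \<le> t then t + - 1 * s + 0 * s\<^sup>2 - (d1 + d2 * t) * k s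
    else - ((d1 + d2 * t) * k s))" for t s
  define H2 where "H2 t s = (if s \<le> t then 1 + 0 * s + 0 * s\<^sup>2 - d2 * k s
    else - (d2 * k s))" for t s
  have H_adm: "admissible_kernel H" "admissible_kernel H1" "admissible_kernel H2"
    unfolding H_def[abs_def] H1_def[abs_def] H2_def[abs_def] k_def
    by (intro admissible_quadratic_kernel continuous_intros; simp)+
  \<comment> \<open>Within distance \<open>\<bar>t - s\<bar>\<close> of \<open>t\<close> the test
    \<open>s \<le> r\<close> does not change its value, so only one branch is
    differentiated.\<close>
  have off_diag: "((\<lambda>r. if s \<le> r then w r else z r) has_real_derivative (if s \<le> t then w' else z'))
      (at t within {0..1})"
    if "(w has_real_derivative w') (at t)" "(z has_real_derivative z') (at t)" "t \<in> {0..1}" "t \<noteq> s"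
    for w z :: "real \<Rightarrow> real" and w' z' s t
  proof (cases "s < t")
    case True
    show ?thesis
      by (rule has_field_derivative_transform_within[of w _ _ _ "t - s"])
         (use that True in \<open>auto simp: dist_real_def has_field_derivative_at_within\<close>)
  next
    case False
    show ?thesis
      by (rule has_field_derivative_transform_within[of z _ _ _ "s - t"])
         (use that False in \<open>auto simp: dist_real_def has_field_derivative_at_within\<close>)
  qed
  have H: "((\<lambda>r. H r s) has_real_derivative H1 t s) (at t within {0..1})"
    if "t \<in> {0..1}" "t \<noteq> s" for t s
    unfolding H_def H1_def
    by (intro off_diag that) (auto intro!: derivative_eq_intros simp: algebra_simps)
  have H1: "((\<lambda>r. H1 r s) has_real_derivative H2 t s) (at t within {0..1})"
    if "t \<in> {0..1}" "t \<noteq> s" for t s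
    unfolding H1_def H2_def
    by (intro off_diag that) (auto intro!: derivative_eq_intros simp: algebra_simps)
  \<comment> \<open>The constant \<open>C\<close> of \<open>explicit_solution\<close> is
    instantiated by its defining expression, and its formulas for the solution and its derivatives
    are instances of \<open>integral_quadratic_kernel\<close>.\<close>
  have H_sol: "deriv3_on01 (\<lambda>t. integral {0..1} (\<lambda>s. H t s * phi s)) (\<lambda>t. integral {0..1} (\<lambda>s. H1 t s * phi s))
        (\<lambda>t. integral {0..1} (\<lambda>s. H2 t s * phi s)) phi"
    "bcs a1 b1 c1 a2 b2 c2 a3 b3 c3 (\<lambda>t. integral {0..1} (\<lambda>s. H t s * phi s))
        (\<lambda>t. integral {0..1} (\<lambda>s. H1 t s * phi s)) (\<lambda>t. integral {0..1} (\<lambda>s. H2 t s * phi s))"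
    if phi: "continuous_on {0..1} phi" for phi
    by (rule explicit_solution[OF phi d refl];
        unfold H_def H1_def H2_def k_def; rule integral_quadratic_kernel[OF phi]; assumption)+
  have ae: "negligible {s\<in>{0..1}. G t s - H t s \<noteq> 0}" if t: "t \<in> {0..1}" for t
  proof (rule negligible_nonzero_of_integral_mult_zero)
    fix phi :: "real \<Rightarrow> real" assume phi: "continuous_on {0..1} phi"
    have "lin_sol a1 b1 c1 a2 b2 c2 a3 b3 c3 phi (\<lambda>t. integral {0..1} (\<lambda>s. H t s * phi s))"
      unfolding lin_sol_def using H_sol[OF phi] by blast
    then have "integral {0..1} (\<lambda>s. H t s * phi s) = integral {0..1} (\<lambda>s. G t s * phi s)"
      using green_functionD(2)[OF green phi t] by blast
    moreover have "((\<lambda>s. G t s * phi s - H t s * phi s) has_integral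
        (integral {0..1} (\<lambda>s. G t s * phi s) - integral {0..1} (\<lambda>s. H t s * phi s))) {0..1}"
      by (intro has_integral_diff integrable_integral green_functionD(1)[OF green phi t]
          admissible_kernelD(1)[OF H_adm(1) t phi])
    ultimately show "((\<lambda>s. (G t s - H t s) * phi s) has_integral 0) {0..1}"
      by (simp add: left_diff_distrib)
  next
    \<comment> \<open>Testing with the constant 1 gives integrability of the kernels
      themselves.\<close>
    show "(\<lambda>s. G t s - H t s) integrable_on {0..1}"
      using integrable_diff[OF green_functionD(1)[OF green _ t, of "\<lambda>_. 1"]
          admissible_kernelD(1)[OF H_adm(1) t, of "\<lambda>_. 1"]] by simp
  qed
  obtain N where N: "negligible N"
    "\<And>t s. \<lbrakk>t \<in> {0..1}; s \<in> {0..1} - (insert t N)\<rbrakk> \<Longrightarrow> G t s = H t s \<and> G1 t s = H1 t s \<and> G2 t s = H2 t s"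
    using kernels_eq_ae[OF G1 G2 H H1 ae] by blast
  \<comment> \<open>Adding \<open>t\<close> removes the diagonal, where the hypotheses say nothing
    about \<open>G1\<close> and \<open>G2\<close>.\<close>
  have N': "negligible (insert t N)" for t using N(1) by simp
  note c0 = admissible_kernel_cong_ae[where N = "\<lambda>t. insert t N" and K = H and K' = G, OF H_adm(1) N']
  note c1 = admissible_kernel_cong_ae[where N = "\<lambda>t. insert t N" and K = H1 and K' = G1, OF H_adm(2) N']
  note c2 = admissible_kernel_cong_ae[where N = "\<lambda>t. insert t N" and K = H2 and K' = G2, OF H_adm(3) N']
  show "admissible_kernel G" by (rule c0(1)) (use N(2) in auto)
  show "admissible_kernel G1" by (rule c1(1)) (use N(2) in auto)
  show "admissible_kernel G2" by (rule c2(1)) (use N(2) in auto)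
  fix phi :: "real \<Rightarrow> real" assume phi: "continuous_on {0..1} phi"
  have eq: "integral {0..1} (\<lambda>s. G t s * phi s) = integral {0..1} (\<lambda>s. H t s * phi s)"
    "integral {0..1} (\<lambda>s. G1 t s * phi s) = integral {0..1} (\<lambda>s. H1 t s * phi s)"
    "integral {0..1} (\<lambda>s. G2 t s * phi s) = integral {0..1} (\<lambda>s. H2 t s * phi s)"
    if t: "t \<in> {0..1}" for t
    subgoal by (rule c0(2)[OF _ t]) (use N(2) in auto)
    subgoal by (rule c1(2)[OF _ t]) (use N(2) in auto)
    subgoal by (rule c2(2)[OF _ t]) (use N(2) in auto)
    done
  show "deriv3_on01 (\<lambda>t. integral {0..1} (\<lambda>s. G t s * phi s)) (\<lambda>t. integral {0..1} (\<lambda>s. G1 t s * phi s))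
        (\<lambda>t. integral {0..1} (\<lambda>s. G2 t s * phi s)) phi \<and>
      bcs a1 b1 c1 a2 b2 c2 a3 b3 c3 (\<lambda>t. integral {0..1} (\<lambda>s. G t s * phi s))
        (\<lambda>t. integral {0..1} (\<lambda>s. G1 t s * phi s)) (\<lambda>t. integral {0..1} (\<lambda>s. G2 t s * phi s))"
    using deriv3_on01_cong[OF H_sol(1)[OF phi]] H_sol(2)[OF phi] eq by (simp add: bcs_def)
qed

section \<open>Regularity up to the endpoints\<close>

text \<open>Derivatives within the interval are unique, one-sidedly at the endpoints too. Equality
  with an integral against \<open>G\<close> thus passes to the first two derivatives.\<close>

lemma deriv3_on01_unique:
  assumes u: "deriv3_on01 u u1 u2 u3" and v: "deriv3_on01 v v1 v2 v3"
    and eq: "\<And>t. t \<in> {0..1} \<Longrightarrow> v t = u t"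
  shows "t \<in> {0..1} \<Longrightarrow> v1 t = u1 t" and "t \<in> {0..1} \<Longrightarrow> v2 t = u2 t"
proof -
  show 1: "v1 t = u1 t" if t: "t \<in> {0..1}" for t
  proof -
    have "(v has_real_derivative u1 t) (at t within {0..1})"
      by (rule has_field_derivative_transform_within[of u _ _ _ 1])
         (use u t eq in \<open>auto simp: deriv3_on01_def\<close>)
    then show ?thesis
      using v t has_field_derivative_unique at_within_01_neq_bot
      unfolding deriv3_on01_def by blast
  qed
  show "v2 t = u2 t" if t: "t \<in> {0..1}" for t
  proof -
    have "(v1 has_real_derivative u2 t) (at t within {0..1})"
      by (rule has_field_derivative_transform_within[of u1 _ _ _ 1])
         (use u t 1 in \<open>auto simp: deriv3_on01_def\<close>)
    then show ?thesis
      using v t has_field_derivative_unique at_within_01_neq_bot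
      unfolding deriv3_on01_def by blast
  qed
qed

text \<open>A derivative on \<open>[0,1]\<close> cannot jump at an endpoint: the difference quotients at \<open>x\<close> are interior
  values of the derivative, by the mean value theorem.\<close>

lemma derivative_bound_closure_01:
  fixes g g' :: "real \<Rightarrow> real"
  assumes g: "\<And>t. t \<in> {0..1} \<Longrightarrow> (g has_real_derivative g' t) (at t within {0..1})"
    and bound: "\<And>t. t \<in> {0<..<1} \<Longrightarrow> \<bar>g' t - L\<bar> \<le> B * \<bar>t - p\<bar>"
    and B: "0 \<le> B" and x: "x \<in> {0..1}"
  shows "\<bar>g' x - L\<bar> \<le> B * \<bar>x - p\<bar>"
proof -
  have mean: "\<exists>z\<in>{a<..<b}. (g b - g a) / (b - a) = g' z" if ab: "0 \<le> a" "a < b" "b \<le> 1" for a b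
  proof -
    have "(g has_derivative (*) (g' z)) (at z within {a..b})" if "a \<le> z" "z \<le> b" for z
      using g[of z] that ab unfolding has_field_derivative_def
      by (auto elim: has_derivative_subset)
    from mvt_simple[OF ab(2) this] show ?thesis
      using ab by (auto simp: field_simps)
  qed
  have quot: "\<bar>(g y - g x) / (y - x) - L\<bar> \<le> B * (\<bar>y - x\<bar> + \<bar>x - p\<bar>)"
    if y: "y \<in> {0..1}" "y \<noteq> x" for y
  proof -
    obtain z where z: "z \<in> {0<..<1}" "\<bar>z - x\<bar> \<le> \<bar>y - x\<bar>" "(g y - g x) / (y - x) = g' z"
    proof (cases "x < y")
      case True
      then obtain z where "z \<in> {x<..<y}" "(g y - g x) / (y - x) = g' z"
        using mean[of x y] x y by auto
      then show ?thesis using that[of z] x y by simp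
    next
      case False
      then obtain z where "z \<in> {y<..<x}" "(g x - g y) / (x - y) = g' z"
        using mean[of y x] x y by auto
      moreover have "(g y - g x) / (y - x) = (g x - g y) / (x - y)"
        by (metis minus_diff_eq minus_divide_divide)
      ultimately show ?thesis using that[of z] x y by simp
    qed
    have "\<bar>g' z - L\<bar> \<le> B * \<bar>z - p\<bar>" using bound[OF z(1)] .
    also have "\<dots> \<le> B * (\<bar>y - x\<bar> + \<bar>x - p\<bar>)"
      using z(2) B by (intro mult_left_mono) auto
    finally show ?thesis by (simp add: z(3))
  qed
  show ?thesis
  proof (rule tendsto_le[OF at_within_01_neq_bot[OF x]])
    show "((\<lambda>y. \<bar>(g y - g x) / (y - x) - L\<bar>) \<longlongrightarrow> \<bar>g' x - L\<bar>) (at x within {0..1})"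
      using g[OF x] unfolding has_field_derivative_iff by (intro tendsto_intros)
    have "((\<lambda>y. B * (\<bar>y - x\<bar> + \<bar>x - p\<bar>)) \<longlongrightarrow> B * (\<bar>x - x\<bar> + \<bar>x - p\<bar>)) (at x within {0..1})"
      by (intro tendsto_intros)
    then show "((\<lambda>y. B * (\<bar>y - x\<bar> + \<bar>x - p\<bar>)) \<longlongrightarrow> B * \<bar>x - p\<bar>) (at x within {0..1})"
      by simp
    show "\<forall>\<^sub>F y in at x within {0..1}. \<bar>(g y - g x) / (y - x) - L\<bar> \<le> B * (\<bar>y - x\<bar> + \<bar>x - p\<bar>)"
      unfolding eventually_at_filter using quot by (intro always_eventually) auto
  qed
qed

text \<open>\<open>u2\<close> is differentiable only in the interior, so its continuity at 0 and 1
  must come from its being the derivative of \<open>u1\<close> on the closed interval. The interior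
  Lipschitz bound is extended to the endpoints in one variable, then in the other.\<close>

lemma deriv3_on01_continuous:
  assumes u: "deriv3_on01 u u1 u2 u3"
    and bound: "\<And>t. t \<in> {0<..<1} \<Longrightarrow> \<bar>u3 t\<bar> \<le> B"
  shows "continuous_on {0..1} u" "continuous_on {0..1} u1" "continuous_on {0..1} u2"
proof -
  have u1: "\<And>t. t \<in> {0..1} \<Longrightarrow> (u1 has_real_derivative u2 t) (at t within {0..1})"
    using u by (auto simp: deriv3_on01_def)
  show "continuous_on {0..1} u" "continuous_on {0..1} u1"
    using u unfolding deriv3_on01_def by (blast intro: DERIV_continuous_on)+
  have B: "0 \<le> B" using bound[of "1/2"] by auto
  have in_in: "\<bar>u2 x - u2 y\<bar> \<le> B * \<bar>x - y\<bar>" if "x \<in> {0<..<1}" "y \<in> {0<..<1}" for x y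
    using field_differentiable_bound[of "{0<..<1}" u2 u3 B x y] u bound that
    by (auto simp: deriv3_on01_def has_field_derivative_at_within)
  have cl_in: "\<bar>u2 x - u2 y\<bar> \<le> B * \<bar>x - y\<bar>" if "x \<in> {0..1}" "y \<in> {0<..<1}" for x y
    by (rule derivative_bound_closure_01[OF u1 in_in[OF _ that(2)] B that(1)])
  have in_cl: "\<bar>u2 x - u2 y\<bar> \<le> B * \<bar>x - y\<bar>" if "x \<in> {0<..<1}" "y \<in> {0..1}" for x y
    using cl_in[OF that(2,1)] by (simp add: abs_minus_commute)
  have "\<bar>u2 x - u2 y\<bar> \<le> B * \<bar>x - y\<bar>" if "x \<in> {0..1}" "y \<in> {0..1}" for x y
    by (rule derivative_bound_closure_01[OF u1 in_cl[OF _ that(2)] B that(1)])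
  then have "B-lipschitz_on {0..1} u2"
    using B by (intro lipschitz_onI) (auto simp: dist_real_def)
  then show "continuous_on {0..1} u2" by (rule lipschitz_on_continuous_on)
qed

section \<open>The contraction and the nonlinear problem\<close>

lemma clamp_01: "clamp 0 1 x \<in> {0..1::real}"
  using clamp_in_interval[of 0 "1::real" x] by simp

theorem theorem3:
  fixes a1 b1 c1 a2 b2 c2 a3 b3 c3 :: real
    and G G1 G2 :: "real \<Rightarrow> real \<Rightarrow> real"
    and f :: "real \<Rightarrow> real \<Rightarrow> real \<Rightarrow> real \<Rightarrow> real"
    and M L0 L1 L2 :: real
  assumes rank: "rank (bc_matrix a1 b1 c1 a2 b2 c2 a3 b3 c3) = 3"
    and green: "is_green_fun a1 b1 c1 a2 b2 c2 a3 b3 c3 G"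
    and G1: "\<And>t s. t \<in> {0..1} \<Longrightarrow> s \<in> {0..1} \<Longrightarrow> t \<noteq> s \<Longrightarrow>
               ((\<lambda>\<tau>. G \<tau> s) has_real_derivative G1 t s) (at t within {0..1})"
    and G2: "\<And>t s. t \<in> {0..1} \<Longrightarrow> s \<in> {0..1} \<Longrightarrow> t \<noteq> s \<Longrightarrow>
               ((\<lambda>\<tau>. G1 \<tau> s) has_real_derivative G2 t s) (at t within {0..1})"
    and nonneg: "M \<ge> 0" "L0 \<ge> 0" "L1 \<ge> 0" "L2 \<ge> 0"
    and cont: "continuous_on (DM (max_abs_int G) (max_abs_int G1) (max_abs_int G2) M)
                 (\<lambda>(t, x, y, z). f t x y z)"
    and bound: "\<And>t x y z. (t, x, y, z) \<in> DM (max_abs_int G) (max_abs_int G1) (max_abs_int G2) M \<Longrightarrow>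
                 \<bar>f t x y z\<bar> \<le> M"
    and lip: "\<And>t x1 y1 z1 x2 y2 z2.
                 (t, x1, y1, z1) \<in> DM (max_abs_int G) (max_abs_int G1) (max_abs_int G2) M \<Longrightarrow>
                 (t, x2, y2, z2) \<in> DM (max_abs_int G) (max_abs_int G1) (max_abs_int G2) M \<Longrightarrow>
                 \<bar>f t x2 y2 z2 - f t x1 y1 z1\<bar> \<le> L0 * \<bar>x2 - x1\<bar> + L1 * \<bar>y2 - y1\<bar> + L2 * \<bar>z2 - z1\<bar>"
    and q: "L0 * max_abs_int G + L1 * max_abs_int G1 + L2 * max_abs_int G2 < 1"
  shows "\<exists>u u1 u2. deriv3_on01 u u1 u2 (\<lambda>t. f t (u t) (u1 t) (u2 t)) \<and>
                   bcs a1 b1 c1 a2 b2 c2 a3 b3 c3 u u1 u2 \<and>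
                   (\<forall>t\<in>{0..1}. \<bar>u t\<bar> \<le> max_abs_int G * M \<and> \<bar>u1 t\<bar> \<le> max_abs_int G1 * M \<and>
                               \<bar>u2 t\<bar> \<le> max_abs_int G2 * M) \<and>
                   (\<forall>v v1 v2. deriv3_on01 v v1 v2 (\<lambda>t. f t (v t) (v1 t) (v2 t)) \<and>
                      bcs a1 b1 c1 a2 b2 c2 a3 b3 c3 v v1 v2 \<and>
                      (\<forall>t\<in>{0..1}. \<bar>v t\<bar> \<le> max_abs_int G * M \<and> \<bar>v1 t\<bar> \<le> max_abs_int G1 * M \<and>
                                  \<bar>v2 t\<bar> \<le> max_abs_int G2 * M)
                      \<longrightarrow> (\<forall>t\<in>{0..1}. v t = u t))"
proof -
  let ?D = "DM (max_abs_int G) (max_abs_int G1) (max_abs_int G2) M"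
  define q where "q = L0 * max_abs_int G + L1 * max_abs_int G1 + L2 * max_abs_int G2"
  define I where "I K phi t = integral {0..1} (\<lambda>s. K t s * phi s)"
    for K :: "real \<Rightarrow> real \<Rightarrow> real" and phi t
  note adm = green_function_kernels(1,2,3)[OF green G1 G2]
  have sol: "deriv3_on01 (I G phi) (I G1 phi) (I G2 phi) phi"
    "bcs a1 b1 c1 a2 b2 c2 a3 b3 c3 (I G phi) (I G1 phi) (I G2 phi)"
    if "continuous_on {0..1} phi" for phi
    using green_function_kernels(4)[OF green G1 G2 that] unfolding I_def[abs_def] by auto
  have q01: "0 \<le> q" "q < 1"
    using nonneg adm[THEN max_abs_int_nonneg] q by (simp_all add: q_def)
  have f_cont: "continuous_on {0..1} (\<lambda>t. f t (u t) (u1 t) (u2 t))"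
    if "continuous_on {0..1} u" "continuous_on {0..1} u1" "continuous_on {0..1} u2"
      "\<And>t. t \<in> {0..1} \<Longrightarrow> (t, u t, u1 t, u2 t) \<in> ?D" for u u1 u2
  proof -
    have "continuous_on {0..1} (\<lambda>t. (t, u t, u1 t, u2 t))"
      by (intro continuous_intros that(1-3))
    from continuous_on_compose2[OF cont this] show ?thesis
      using that(4) by (simp add: image_subset_iff)
  qed
  \<comment> \<open>Bounded continuous functions on the whole line stand in for
    \<open>C[0,1]\<close>, providing a complete metric space; the operators \<open>I\<close> see
    only values on \<open>{0..1}\<close>.\<close>
  define S where "S = (cball 0 M :: (real \<Rightarrow>\<^sub>C real) set)"
  have SD: "\<bar>phi s\<bar> \<le> M" if "phi \<in> S" for phi :: "real \<Rightarrow>\<^sub>C real" and s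
    using norm_bounded[of phi s] that by (simp add: S_def dist_norm)
  have SI: "phi \<in> S" if "\<And>s. \<bar>phi s\<bar> \<le> M" for phi :: "real \<Rightarrow>\<^sub>C real"
    using norm_bound[of phi M] that by (simp add: S_def dist_norm)
  have inD: "(t, I G phi t, I G1 phi t, I G2 phi t) \<in> ?D" if "phi \<in> S" "t \<in> {0..1}" for phi :: "real \<Rightarrow>\<^sub>C real" and t
    using admissible_kernel_integral_bound[OF adm(1) that(2), of phi M]
      admissible_kernel_integral_bound[OF adm(2) that(2), of phi M]
      admissible_kernel_integral_bound[OF adm(3) that(2), of phi M] SD[OF that(1)] that(2)
    by (simp add: DM_def I_def)
  \<comment> \<open>A continuous function on \<open>{0..1}\<close> is extended by its endpoint
    values.\<close>
  have ex: "\<exists>g::real \<Rightarrow>\<^sub>C real. \<forall>x. g x = h (clamp 0 1 x)" if "continuous_on {0..1} h" for h :: "real \<Rightarrow> real"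
    using continuous_on_cbox_bcontfunE[of 0 1 h] that by (metis box_real(2))
  \<comment> \<open>The chosen function is known to have the stated values only for
    \<open>phi\<close> in \<open>S\<close>, where the arguments of \<open>f\<close> stay in
    \<open>?D\<close> and the composition is continuous.\<close>
  define T where "T phi = (SOME g::real \<Rightarrow>\<^sub>C real. \<forall>x. g x = (\<lambda>t. f t (I G phi t) (I G1 phi t) (I G2 phi t)) (clamp 0 1 x))"
    for phi :: "real \<Rightarrow>\<^sub>C real"
  have T: "T phi x = (\<lambda>t. f t (I G phi t) (I G1 phi t) (I G2 phi t)) (clamp 0 1 x)"
    if "phi \<in> S" for phi x
  proof -
    have "continuous_on {0..1} (\<lambda>t. f t (I G phi t) (I G1 phi t) (I G2 phi t))"
      by (intro f_cont deriv3_on01_continuous[OF sol(1), of phi M] inD SD that) auto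
    from someI_ex[OF ex[OF this]] show ?thesis unfolding T_def by blast
  qed
  have "\<exists>!phi\<in>S. T phi = phi"
  proof (rule Banach_fix[OF _ _ q01])
    show "complete S" by (simp add: S_def complete_eq_closed)
    show "S \<noteq> {}" using nonneg by (simp add: S_def)
    show "T ` S \<subseteq> S"
    proof (intro image_subsetI SI)
      fix phi s assume phi: "phi \<in> S"
      show "\<bar>T phi s\<bar> \<le> M"
        unfolding T[OF phi] by (rule bound[OF inD[OF phi clamp_01]])
    qed
    fix phi psi :: "real \<Rightarrow>\<^sub>C real" assume S: "phi \<in> S" "psi \<in> S"
    have "dist (T phi x) (T psi x) \<le> q * dist phi psi" for x
    proof -
      let ?c = "clamp 0 1 x" and ?d = "dist phi psi"
      have le: "\<bar>phi s - psi s\<bar> \<le> ?d" for s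
        using dist_bounded[of phi s psi] by (simp add: dist_real_def)
      have K: "\<bar>I K phi ?c - I K psi ?c\<bar> \<le> max_abs_int K * ?d" if "admissible_kernel K" for K
        unfolding I_def by (rule admissible_kernel_integral_diff_bound[OF that clamp_01]) (auto intro: le)
      have "dist (T phi x) (T psi x) \<le> L0 * \<bar>I G phi ?c - I G psi ?c\<bar>
          + L1 * \<bar>I G1 phi ?c - I G1 psi ?c\<bar> + L2 * \<bar>I G2 phi ?c - I G2 psi ?c\<bar>"
        using lip[OF inD[OF S(2) clamp_01] inD[OF S(1) clamp_01], of x] by (simp add: T S dist_real_def)
      also have "\<dots> \<le> L0 * (max_abs_int G * ?d) + L1 * (max_abs_int G1 * ?d) + L2 * (max_abs_int G2 * ?d)"
        using nonneg adm K by (intro add_mono mult_left_mono) auto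
      finally show ?thesis by (simp add: q_def algebra_simps)
    qed
    then show "dist (T phi) (T psi) \<le> q * dist phi psi" by (rule dist_bound)
  qed
  then obtain phi where phi: "phi \<in> S" "T phi = phi"
    and uniq: "\<And>psi. \<lbrakk>psi \<in> S; T psi = psi\<rbrakk> \<Longrightarrow> psi = phi" by blast
  \<comment> \<open>On \<open>{0..1}\<close> clamping is the identity, so the fixed point equation
    becomes the differential equation.\<close>
  have phi_eq: "phi t = f t (I G phi t) (I G1 phi t) (I G2 phi t)" if "t \<in> {0..1}" for t
    using T[OF phi(1), of t] phi(2) that by simp
  show ?thesis
  proof (intro exI conjI allI impI)
    show "deriv3_on01 (I G phi) (I G1 phi) (I G2 phi) (\<lambda>t. f t (I G phi t) (I G1 phi t) (I G2 phi t))"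
      using deriv3_on01_cong[OF sol(1)[of phi]] phi_eq by simp
    show "bcs a1 b1 c1 a2 b2 c2 a3 b3 c3 (I G phi) (I G1 phi) (I G2 phi)"
      using sol(2)[of phi] by simp
    show "\<forall>t\<in>{0..1}. \<bar>I G phi t\<bar> \<le> max_abs_int G * M \<and> \<bar>I G1 phi t\<bar> \<le> max_abs_int G1 * M \<and>
        \<bar>I G2 phi t\<bar> \<le> max_abs_int G2 * M"
      using inD[OF phi(1)] by (simp add: DM_def)
  next
    fix v v1 v2
    assume *: "deriv3_on01 v v1 v2 (\<lambda>t. f t (v t) (v1 t) (v2 t)) \<and>
      bcs a1 b1 c1 a2 b2 c2 a3 b3 c3 v v1 v2 \<and>
      (\<forall>t\<in>{0..1}. \<bar>v t\<bar> \<le> max_abs_int G * M \<and> \<bar>v1 t\<bar> \<le> max_abs_int G1 * M \<and>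
        \<bar>v2 t\<bar> \<le> max_abs_int G2 * M)"
    then have v: "deriv3_on01 v v1 v2 (\<lambda>t. f t (v t) (v1 t) (v2 t))" by blast
    have vD: "(t, v t, v1 t, v2 t) \<in> ?D" if "t \<in> {0..1}" for t
      using * that by (auto simp: DM_def)
    \<comment> \<open>The bounds on \<open>v\<close> keep its third derivative below
      \<open>M\<close>, which gives continuity of \<open>v2\<close> up to the endpoints.\<close>
    have "continuous_on {0..1} (\<lambda>t. f t (v t) (v1 t) (v2 t))"
      by (intro f_cont vD deriv3_on01_continuous[OF v, of M] bound) auto
    \<comment> \<open>\<open>psi\<close> is the third derivative of \<open>v\<close>, extended to
      the line. Uniqueness for the linear problem then recovers \<open>v\<close> from
      \<open>psi\<close>.\<close>
    from ex[OF this] obtain psi :: "real \<Rightarrow>\<^sub>C real" where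
      psi: "\<And>x. psi x = (\<lambda>t. f t (v t) (v1 t) (v2 t)) (clamp 0 1 x)" by blast
    have psi01: "psi t = f t (v t) (v1 t) (v2 t)" if "t \<in> {0..1}" for t
      using psi[of t] that by simp
    have psiS: "psi \<in> S" by (intro SI, unfold psi) (rule bound[OF vD[OF clamp_01]])
    have v_psi: "deriv3_on01 v v1 v2 psi"
      using deriv3_on01_cong[OF v] psi01 by simp
    then have "lin_sol a1 b1 c1 a2 b2 c2 a3 b3 c3 psi v"
      unfolding lin_sol_def using * by blast
    then have v0: "v t = I G psi t" if "t \<in> {0..1}" for t
      unfolding I_def by (intro green_functionD(2)[OF green _ that]) auto
    have v12: "v1 t = I G1 psi t" "v2 t = I G2 psi t" if "t \<in> {0..1}" for t
      using deriv3_on01_unique[OF sol(1)[of psi] v_psi v0] that by auto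
    \<comment> \<open>Both sides depend on a point only through its clamped value, so agreement on
      \<open>{0..1}\<close> gives equality on the whole line.\<close>
    then have "T psi = psi"
      using v0[OF clamp_01] v12[OF clamp_01] by (intro bcontfun_eqI) (simp add: T[OF psiS] psi)
    then have "psi = phi" using psiS uniq by blast
    then show "\<forall>t\<in>{0..1}. v t = I G phi t" using v0 by simp
  qed
qed

end
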